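(* Let $(X_n)_{n\ge1}$ be the elephant random walk with delays in which the elephant remembers only the most recent step, i.e. with memory $\mathfrak{M}_n=\{n\}$ for all $n\ge1$, and with parameters $p,q,r\in(0,1)$, $p+q+r=1$. Let $N_n$ be the number of zero steps and $N^*_n$ the number of nonzero steps among $X_1,\ldots,X_n$, and let $\tau=\min\{n\ge1:X_n=0\}$. Then $$N^*_n=n-N_n\to Z\quad\text{almost surely as }n\to\infty,$$ where $Z=\tau-1$ is a geometric random variable with mean $\frac{1-r}{r}$. Moreover, all moments converge, i.e. $E((N^*_n)^k)\to E(Z^k)$ as $n\to\infty$ for every $k\in\mathbb{N}$.
   Context: Elephant random walk with delays, memory consisting of the most recent step only: fix $p,q,r\in(0,1)$ with $p+q+r=1$. The steps take values in $\{-1,0,1\}$. The first step satisfies $P(X_1=1)=p$, $P(X_1=-1)=q$, $P(X_1=0)=r$. For each $n\ge1$, independently of the past $X_1,\ldots,X_n$, the next step is determined by $X_{n+1}=X_n$ with probability $p$, $X_{n+1}=-X_n$ with probability $q$, and $X_{n+1}=0$ with probability $r$. Notation: $N_n=\sum_{k=1}^n\mathbf{1}_{\{X_k=0\}}$ and $N^*_n=\sum_{k=1}^n\mathbf{1}_{\{X_k\neq0\}}$. "Geometric with mean $(1-r)/r$" means $P(Z=k)=(1-r)^kr$ for $k=0,1,2,\ldots$. *)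

theory Defs
  imports "HOL-Probability.Probability"
begin

text \<open>
  The decision taken at time \<open>n\<close> is encoded by a factor \<open>D\<close> with values in \<open>{-1, 0, 1}\<close>:
  repeat the remembered step (1), reverse it (-1), or stay put (0). Only the steps
  \<open>X n\<close> with \<open>n \<ge> 1\<close> are meaningful. A separate factor is required to exist for each \<open>n\<close>,
  independent of the sigma-algebra generated by \<open>X 1, \<dots>, X n\<close>.
\<close>

locale last_step_elephant_walk = prob_space M for M :: "'a measure" +
  fixes p q r :: real and X :: "nat \<Rightarrow> 'a \<Rightarrow> int"
  assumes p: "0 < p" "p < 1"
    and q: "0 < q" "q < 1"
    and r: "0 < r" "r < 1"
    and pqr: "p + q + r = 1"
    and steps: "\<And>n. n \<ge> 1 \<Longrightarrow> X n \<in> measurable M (count_space {-1, 0, 1})"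
    and first_step:
      "prob {\<omega> \<in> space M. X 1 \<omega> = 1} = p"
      "prob {\<omega> \<in> space M. X 1 \<omega> = -1} = q"
      "prob {\<omega> \<in> space M. X 1 \<omega> = 0} = r"
    and next_step: "\<And>n. n \<ge> 1 \<Longrightarrow>
      \<exists>D \<in> measurable M (count_space {-1, 0, 1 :: int}).
        prob {\<omega> \<in> space M. D \<omega> = 1} = p \<and>
        prob {\<omega> \<in> space M. D \<omega> = -1} = q \<and>
        prob {\<omega> \<in> space M. D \<omega> = 0} = r \<and>
        indep_set
          (sets (vimage_algebra (space M) (\<lambda>\<omega>. \<lambda>k\<in>{1..n}. X k \<omega>)
                   (PiM {1..n} (\<lambda>_. count_space {-1, 0, 1}))))
          (sets (vimage_algebra (space M) D (count_space {-1, 0, 1}))) \<and>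
        (AE \<omega> in M. X (n + 1) \<omega> = D \<omega> * X n \<omega>)"

definition zero_steps :: "(nat \<Rightarrow> 'a \<Rightarrow> int) \<Rightarrow> nat \<Rightarrow> 'a \<Rightarrow> nat" where
  "zero_steps X n \<omega> = (\<Sum>k = 1..n. of_bool (X k \<omega> = 0))"

definition nonzero_steps :: "(nat \<Rightarrow> 'a \<Rightarrow> int) \<Rightarrow> nat \<Rightarrow> 'a \<Rightarrow> nat" where
  "nonzero_steps X n \<omega> = (\<Sum>k = 1..n. of_bool (X k \<omega> \<noteq> 0))"

text \<open>The value is unspecified on paths that never take a zero step.\<close>

definition first_zero_time :: "(nat \<Rightarrow> 'a \<Rightarrow> int) \<Rightarrow> 'a \<Rightarrow> nat" where
  "first_zero_time X \<omega> = (LEAST n. n \<ge> 1 \<and> X n \<omega> = 0)"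

end

theory Submission
  imports Defs
begin

text \<open>
  Zero is absorbing, because the next step is a multiple of the last one. Hence almost surely the
  first \<open>n\<close> steps contain exactly \<open>min n Z\<close> nonzero ones. The walk survives each step without a
  zero with probability \<open>1 - r\<close>, independently of the past, so \<open>Z\<close> is geometric; convergence of the
  moments is dominated convergence, since \<open>min n Z \<le> Z\<close> and \<open>Z\<close> has all moments.
\<close>

text \<open>By the ratio test the power series with coefficients \<open>real n ^ k\<close> has
  radius of convergence 1, and \<open>c\<close> lies strictly inside.\<close>

lemma summable_power_times_geometric:
  fixes c :: real
  assumes "\<bar>c\<bar> < 1"
  shows "summable (\<lambda>n. real n ^ k * c ^ n)"
proof (rule summable_in_conv_radius)
  have "(\<lambda>n. (real n / real (Suc n)) ^ k) \<longlonglongrightarrow> 1 ^ k"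
    by (intro tendsto_power LIMSEQ_n_over_Suc_n)
  then have "(\<lambda>n. norm (real n ^ k) / norm (real (Suc n) ^ k)) \<longlonglongrightarrow> 1"
    by (simp add: power_divide del: of_nat_Suc)
  then have "conv_radius (\<lambda>n. real n ^ k) = ereal 1"
    \<comment> \<open>For \<open>k > 0\<close> the coefficient at \<open>n = 0\<close> vanishes, so
      nonvanishing is checked only eventually.\<close>
    by (intro conv_radius_ratio_limit[OF refl])
       (auto intro!: always_eventually eventually_mono[OF eventually_gt_at_top[of 0]])
  with assms show "ereal (norm c) < conv_radius (\<lambda>n. real n ^ k)"
    by simp
qed

text \<open>Integrability here amounts to absolute summability of the series weighted with the
  masses \<open>r * (1 - r) ^ n\<close>, which is the previous lemma at
  \<open>c = 1 - r\<close>.\<close>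

lemma integrable_power_geometric_pmf:
  assumes "0 < r" "r < 1"
  shows "integrable (geometric_pmf r) (\<lambda>n. real n ^ k)"
proof -
  have "summable (\<lambda>n. r * (real n ^ k * (1 - r) ^ n))"
    using assms by (intro summable_mult summable_power_times_geometric) auto
  then show ?thesis
    using assms
    by (simp add: measure_pmf_eq_density integrable_density integrable_count_space_nat_iff
        abs_mult power_abs mult_ac)
qed

context last_step_elephant_walk
begin

lemma pred_zero_step:
  assumes "n \<ge> 1"
  shows "Measurable.pred M (\<lambda>\<omega>. X n \<omega> = 0)"
proof -
  have "{\<omega> \<in> space M. X n \<omega> = 0} = X n -` {0} \<inter> space M"
    by auto
  also have "\<dots> \<in> sets M"
    using steps[OF assms] by (rule measurable_sets) auto
  finally show ?thesis
    by (simp add: pred_def)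
qed

lemma step_range: "n \<ge> 1 \<Longrightarrow> \<omega> \<in> space M \<Longrightarrow> X n \<omega> \<in> {-1, 0, 1}"
  using measurable_space[OF steps] by (simp only: space_count_space)

text \<open>Up to a null set this is the tail event that \<open>survival_time\<close> is at least
  \<open>n\<close>. Phrased through the steps, it visibly depends on the past only, as independence
  requires.\<close>

definition survival :: "nat \<Rightarrow> 'a set" where
  "survival n = {\<omega> \<in> space M. \<forall>k\<in>{1..n}. X k \<omega> \<noteq> 0}"

lemma sets_survival [measurable]: "survival n \<in> sets M"
  unfolding survival_def by (intro predE pred_intros_finite pred_intros_logic pred_zero_step) auto

lemma survival_antimono: "m \<le> n \<Longrightarrow> survival n \<subseteq> survival m"
  by (auto simp: survival_def)

text \<open>As the steps only take the values -1, 0 and 1, survival is the preimage of a box with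
  all sides \<open>{-1, 1}\<close>. This membership makes the event independent of the next
  decision.\<close>

lemma survival_in_past:
  "survival n \<in> sets (vimage_algebra (space M) (\<lambda>\<omega>. \<lambda>k\<in>{1..n}. X k \<omega>)
     (PiM {1..n} (\<lambda>_. count_space {-1, 0, 1})))"
proof -
  have "survival n = (\<lambda>\<omega>. \<lambda>k\<in>{1..n}. X k \<omega>) -` (PiE {1..n} (\<lambda>_. {-1, 1})) \<inter> space M"
    using step_range by (fastforce simp: survival_def PiE_iff)
  also have "\<dots> \<in> sets (vimage_algebra (space M) (\<lambda>\<omega>. \<lambda>k\<in>{1..n}. X k \<omega>)
     (PiM {1..n} (\<lambda>_. count_space {-1, 0, 1})))"
    by (intro in_vimage_algebra sets_PiM_I_finite) auto
  finally show ?thesis .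
qed

lemma prob_survival_Suc: "prob (survival (Suc n)) = (1 - r) * prob (survival n)"
\<comment> \<open>The first step has its own law; the decision factor exists only for
  \<open>n \<ge> 1\<close>.\<close>
proof (cases "n = 0")
  case True
  have "survival 1 = space M - {\<omega> \<in> space M. X 1 \<omega> = 0}" "survival 0 = space M"
    by (auto simp: survival_def)
  then show ?thesis
    using True first_step pred_zero_step[of 1] by (simp add: prob_compl prob_space pred_def)
next
  case False
  then have "n \<ge> 1"
    by simp
  from next_step[OF this] obtain D where D: "D \<in> measurable M (count_space {-1, 0, 1 :: int})"
    and zero: "prob {\<omega> \<in> space M. D \<omega> = 0} = r"
    and indep: "indep_set
          (sets (vimage_algebra (space M) (\<lambda>\<omega>. \<lambda>k\<in>{1..n}. X k \<omega>)
                   (PiM {1..n} (\<lambda>_. count_space {-1, 0, 1}))))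
          (sets (vimage_algebra (space M) D (count_space {-1, 0, 1})))"
    and step: "AE \<omega> in M. X (n + 1) \<omega> = D \<omega> * X n \<omega>"
    by blast
  define B where "B = D -` {-1, 1} \<inter> space M"
  have B: "B \<in> sets M"
    unfolding B_def using D by (rule measurable_sets) auto
  have range: "D \<omega> \<in> {-1, 0, 1}" if "\<omega> \<in> space M" for \<omega>
    using measurable_space[OF D that] by (simp only: space_count_space)
  have "{\<omega> \<in> space M. D \<omega> = 0} = space M - B"
    using range by (fastforce simp: B_def)
  then have prob_B: "prob B = 1 - r"
    using zero B by (simp add: prob_compl)
  \<comment> \<open>A product of integers vanishes iff a factor does. As \<open>n \<ge> 1\<close>,
    survival up to \<open>n\<close> includes that \<open>X n\<close> is nonzero, so only
    \<open>D\<close> can produce the new zero.\<close>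
  have "AE \<omega> in M. \<omega> \<in> survival (Suc n) \<longleftrightarrow> \<omega> \<in> survival n \<inter> B"
    using step AE_space
  proof eventually_elim
    case (elim \<omega>)
    then show ?case
      using False range[of \<omega>] by (auto simp: survival_def B_def atLeastAtMostSuc_conv)
  qed
  then have "prob (survival (Suc n)) = prob (survival n \<inter> B)"
    using B by (intro finite_measure_eq_AE) auto
  also have "\<dots> = prob (survival n) * prob B"
    using indep survival_in_past by (rule indep_setD) (auto simp: B_def intro!: in_vimage_algebra)
  finally show ?thesis
    by (simp add: prob_B)
qed

lemma prob_survival: "prob (survival n) = (1 - r) ^ n"
  by (induction n) (simp_all add: prob_survival_Suc, simp add: survival_def prob_space)

text \<open>A path without zeros lies in every survival event, and the probabilities of these tend
  to 0.\<close>

lemma AE_zero_step: "AE \<omega> in M. \<exists>n\<ge>1. X n \<omega> = 0"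
proof -
  let ?N = "\<Inter>n. survival n"
  have "prob ?N \<le> (1 - r) ^ n" for n
    using finite_measure_mono[of ?N "survival n"] by (simp add: prob_survival Inter_lower)
  moreover have "(\<lambda>n. (1 - r) ^ n) \<longlonglongrightarrow> 0"
    using r by (intro LIMSEQ_realpow_zero) auto
  ultimately have "prob ?N \<le> 0"
    by (intro LIMSEQ_le_const) auto
  then have "?N \<in> null_sets M"
    by (simp add: null_sets_def emeasure_eq_measure measure_le_0_iff)
  then show ?thesis
    by (rule AE_I') (auto simp: survival_def)
qed

text \<open>Each single transition preserves zero outside a null set. There are countably many
  transitions, so one null set serves all, and induction then runs along a fixed path.\<close>

lemma AE_zero_absorbing: "AE \<omega> in M. \<forall>n\<ge>1. \<forall>m\<ge>n. X n \<omega> = 0 \<longrightarrow> X m \<omega> = 0"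
proof -
  have "AE \<omega> in M. n \<ge> 1 \<longrightarrow> X n \<omega> = 0 \<longrightarrow> X (Suc n) \<omega> = 0" for n
  proof (cases "n \<ge> 1")
    case True
    then obtain D where "AE \<omega> in M. X (n + 1) \<omega> = D \<omega> * X n \<omega>"
      using next_step[of n] by blast
    then show ?thesis
      by eventually_elim simp
  qed simp
  then have "AE \<omega> in M. \<forall>n. n \<ge> 1 \<longrightarrow> X n \<omega> = 0 \<longrightarrow> X (Suc n) \<omega> = 0"
    by (simp add: AE_all_countable)
  then show ?thesis
  proof eventually_elim
    case (elim \<omega>)
    have "X m \<omega> = 0" if "n \<le> m" "n \<ge> 1" "X n \<omega> = 0" for n m
      using that by (induction m rule: dec_induct) (use elim in auto)
    then show ?case
      by blast
  qed
qed

text \<open>The variable \<open>Z\<close> of the theorem. The truncated subtraction loses nothing on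
  paths with a zero step, where the first zero time is at least 1.\<close>

definition survival_time :: "'a \<Rightarrow> nat" where
  "survival_time \<omega> = first_zero_time X \<omega> - 1"

lemma measurable_survival_time [measurable]: "survival_time \<in> measurable M (count_space UNIV)"
proof -
  \<comment> \<open>Nothing is assumed about \<open>X 0\<close>; at \<open>n = 0\<close> the guard
    makes the predicate constantly false.\<close>
  have "Measurable.pred M (\<lambda>\<omega>. n \<ge> 1 \<and> X n \<omega> = 0)" for n
    by (cases "n \<ge> 1") (auto intro: pred_zero_step)
  then have "first_zero_time X \<in> measurable M (count_space UNIV)"
    unfolding first_zero_time_def by (rule measurable_Least)
  then show ?thesis
    unfolding survival_time_def by measurable
qed

text \<open>A pathwise fact; the hypothesis excludes paths on which \<open>LEAST\<close> is
  unspecified. The inequality is strict because \<open>survival_time\<close> is one less than the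
  first zero time.\<close>

lemma zero_before_iff:
  assumes "\<exists>n\<ge>1. X n \<omega> = 0"
  shows "(\<exists>k\<in>{1..n}. X k \<omega> = 0) \<longleftrightarrow> survival_time \<omega> < n"
proof
  have first: "first_zero_time X \<omega> \<ge> 1" "X (first_zero_time X \<omega>) \<omega> = 0"
    unfolding first_zero_time_def using LeastI_ex[of "\<lambda>n. n \<ge> 1 \<and> X n \<omega> = 0"] assms by auto
  show "survival_time \<omega> < n" if "\<exists>k\<in>{1..n}. X k \<omega> = 0"
  proof -
    from that obtain k where "1 \<le> k" "k \<le> n" "X k \<omega> = 0"
      by auto
    then have "first_zero_time X \<omega> \<le> n"
      unfolding first_zero_time_def by (intro order.trans[OF Least_le[of _ k]]) auto
    with first show ?thesis
      by (simp add: survival_time_def)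
  qed
  show "\<exists>k\<in>{1..n}. X k \<omega> = 0" if "survival_time \<omega> < n"
    using that first by (intro bexI[of _ "first_zero_time X \<omega>"]) (auto simp: survival_time_def)
qed

lemma AE_nonzero_steps: "AE \<omega> in M. \<forall>n. nonzero_steps X n \<omega> = min n (survival_time \<omega>)"
  using AE_zero_absorbing AE_zero_step
proof eventually_elim
  case (elim \<omega>)
  \<comment> \<open>Absorption reduces the existence of a zero among the first \<open>k\<close>
    steps to the \<open>k\<close>-th step being zero.\<close>
  have "X k \<omega> = 0 \<longleftrightarrow> survival_time \<omega> < k" if "k \<ge> 1" for k
    using zero_before_iff[OF elim(2), of k] elim(1) that by force
  then have "nonzero_steps X n \<omega> = (\<Sum>k = 1..n. of_bool (k \<le> survival_time \<omega>))" for n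
    unfolding nonzero_steps_def by (intro sum.cong) auto
  moreover have "{1..n} \<inter> {k. k \<le> survival_time \<omega>} = {1..min n (survival_time \<omega>)}" for n
    by auto
  ultimately show ?case
    by (simp add: of_bool_def sum.If_cases)
qed

text \<open>Almost surely the value \<open>n\<close> means surviving \<open>n\<close> steps but not
  \<open>n + 1\<close>, so the mass is a difference of consecutive powers of
  \<open>1 - r\<close>.\<close>

lemma prob_survival_time: "prob {\<omega> \<in> space M. survival_time \<omega> = n} = (1 - r) ^ n * r"
proof -
  have "AE \<omega> in M. \<omega> \<in> {\<omega> \<in> space M. survival_time \<omega> = n}
      \<longleftrightarrow> \<omega> \<in> survival n - survival (Suc n)"
    using AE_zero_step AE_space
  proof eventually_elim
    case (elim \<omega>)
    have "\<omega> \<in> survival m \<longleftrightarrow> m \<le> survival_time \<omega>" for m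
      using zero_before_iff[OF elim(1), of m] elim(2) by (auto simp: survival_def not_less)
    then show ?case
      using elim(2) by auto
  qed
  then have "prob {\<omega> \<in> space M. survival_time \<omega> = n} = prob (survival n - survival (Suc n))"
    by (intro finite_measure_eq_AE) auto
  also have "\<dots> = (1 - r) ^ n - (1 - r) ^ Suc n"
    using survival_antimono[of n "Suc n"] by (subst finite_measure_Diff) (auto simp: prob_survival)
  finally show ?thesis
    by (simp add: algebra_simps)
qed

text \<open>On a countable space singletons determine the measure. \<open>geometric_pmf r\<close>
  counts failures before the first success, so it starts at 0 and has exactly these masses.\<close>

lemma distr_survival_time:
  "distr M (count_space UNIV) survival_time = measure_pmf (geometric_pmf r)"
proof (rule measure_eqI_countable[of _ UNIV])
  show "emeasure (distr M (count_space UNIV) survival_time) {n} = emeasure (geometric_pmf r) {n}"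
    for n
    using r prob_survival_time[of n]
    by (simp add: emeasure_distr emeasure_pmf_single emeasure_eq_measure vimage_def
        Int_def conj_commute)
qed auto

lemma integrable_survival_time_power: "integrable M (\<lambda>\<omega>. real (survival_time \<omega>) ^ k)"
  using integrable_power_geometric_pmf[OF r, of k] unfolding distr_survival_time[symmetric]
  by (subst (asm) integrable_distr_eq) auto

lemma expectation_survival_time: "expectation (\<lambda>\<omega>. real (survival_time \<omega>)) = (1 - r) / r"
proof -
  have "expectation (\<lambda>\<omega>. real (survival_time \<omega>))
      = (\<integral>n. real n \<partial>distr M (count_space UNIV) survival_time)"
    by (subst integral_distr) auto
  then show ?thesis
    using r by (simp add: distr_survival_time expectation_geometric_pmf)
qed

lemma measurable_nonzero_steps [measurable]: "nonzero_steps X n \<in> measurable M (count_space UNIV)"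
proof -
  have "(\<lambda>\<omega>. of_bool (X k \<omega> \<noteq> 0) :: nat) \<in> measurable M (count_space UNIV)" if "k \<in> {1..n}" for k
  proof -
    have [measurable]: "Measurable.pred M (\<lambda>\<omega>. X k \<omega> = 0)"
      using that by (intro pred_zero_step) simp
    show ?thesis
      unfolding of_bool_def by measurable
  qed
  then show ?thesis
    unfolding nonzero_steps_def by measurable
qed

lemma integrable_nonzero_steps_power: "integrable M (\<lambda>\<omega>. real (nonzero_steps X n \<omega>) ^ k)"
  using integrable_survival_time_power
proof (rule Bochner_Integration.integrable_bound)
  show "AE \<omega> in M. norm (real (nonzero_steps X n \<omega>) ^ k) \<le> norm (real (survival_time \<omega>) ^ k)"
    using AE_nonzero_steps by eventually_elim (auto intro!: power_mono)
qed measurable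

lemma AE_nonzero_steps_tendsto:
  "AE \<omega> in M. (\<lambda>n. real (nonzero_steps X n \<omega>)) \<longlonglongrightarrow> real (survival_time \<omega>)"
  using AE_nonzero_steps
proof eventually_elim
  case (elim \<omega>)
  \<comment> \<open>The sequence is not merely convergent: it is constant from index
    \<open>survival_time \<omega>\<close> on.\<close>
  have "eventually (\<lambda>n. real (nonzero_steps X n \<omega>) = real (survival_time \<omega>)) sequentially"
    using eventually_ge_at_top[of "survival_time \<omega>"]
    by eventually_elim (simp add: elim)
  then show ?case
    by (rule tendsto_eventually)
qed

lemma nonzero_steps_moment_tendsto:
  "(\<lambda>n. expectation (\<lambda>\<omega>. real (nonzero_steps X n \<omega>) ^ k))
     \<longlonglongrightarrow> expectation (\<lambda>\<omega>. real (survival_time \<omega>) ^ k)"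
proof (rule integral_dominated_convergence)
  show "integrable M (\<lambda>\<omega>. real (survival_time \<omega>) ^ k)"
    by (rule integrable_survival_time_power)
  show "AE \<omega> in M. (\<lambda>n. real (nonzero_steps X n \<omega>) ^ k) \<longlonglongrightarrow> real (survival_time \<omega>) ^ k"
    using AE_nonzero_steps_tendsto by eventually_elim (rule tendsto_power)
  \<comment> \<open>The limit itself dominates, since the minimum with \<open>n\<close> never
    exceeds \<open>survival_time\<close>.\<close>
  show "AE \<omega> in M. norm (real (nonzero_steps X n \<omega>) ^ k) \<le> real (survival_time \<omega>) ^ k" for n
    using AE_nonzero_steps by eventually_elim (auto intro!: power_mono)
qed measurable

end

lemma nonzero_steps_add_zero_steps: "nonzero_steps X n \<omega> + zero_steps X n \<omega> = n"
proof -
  have "nonzero_steps X n \<omega> + zero_steps X n \<omega> = (\<Sum>k = 1..n. 1)"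
    unfolding nonzero_steps_def zero_steps_def sum.distrib[symmetric] by (intro sum.cong) auto
  then show ?thesis
    by simp
qed

theorem theorem5p1:
  fixes M :: "'a measure" and p q r :: real and X :: "nat \<Rightarrow> 'a \<Rightarrow> int"
    and Z :: "'a \<Rightarrow> nat"
  assumes walk: "last_step_elephant_walk M p q r X"
    and Z: "\<And>\<omega>. Z \<omega> = first_zero_time X \<omega> - 1"
  shows "(AE \<omega> in M. \<exists>n\<ge>1. X n \<omega> = 0)
    \<and> (\<forall>n. \<forall>\<omega>\<in>space M. real (nonzero_steps X n \<omega>) = real n - real (zero_steps X n \<omega>))
    \<and> (AE \<omega> in M. (\<lambda>n. real (nonzero_steps X n \<omega>)) \<longlonglongrightarrow> real (Z \<omega>))
    \<and> Z \<in> measurable M (count_space UNIV)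
    \<and> distr M (count_space UNIV) Z = measure_pmf (geometric_pmf r)
    \<and> integrable M (\<lambda>\<omega>. real (Z \<omega>))
    \<and> (\<integral>\<omega>. real (Z \<omega>) \<partial>M) = (1 - r) / r
    \<and> (\<forall>k::nat. integrable M (\<lambda>\<omega>. real (Z \<omega>) ^ k)
        \<and> (\<forall>n. integrable M (\<lambda>\<omega>. real (nonzero_steps X n \<omega>) ^ k))
        \<and> (\<lambda>n. \<integral>\<omega>. real (nonzero_steps X n \<omega>) ^ k \<partial>M)
            \<longlonglongrightarrow> (\<integral>\<omega>. real (Z \<omega>) ^ k \<partial>M))"
proof -
  interpret last_step_elephant_walk M p q r X
    by (rule walk)
  have Z_eq: "Z = survival_time"
    by (simp add: fun_eq_iff Z survival_time_def)
  have "real (nonzero_steps X n \<omega>) = real n - real (zero_steps X n \<omega>)" for n \<omega>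
    using nonzero_steps_add_zero_steps[of X n \<omega>] by linarith
  moreover have "integrable M (\<lambda>\<omega>. real (survival_time \<omega>))"
    using integrable_survival_time_power[of 1] by simp
  ultimately show ?thesis
    unfolding Z_eq
    by (intro conjI allI ballI AE_zero_step AE_nonzero_steps_tendsto measurable_survival_time
        distr_survival_time expectation_survival_time integrable_survival_time_power
        integrable_nonzero_steps_power nonzero_steps_moment_tendsto)
qed

end
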